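(* Let $p\in\overline{\mathbb P}\subseteq\beta\mathbb N$ be a prime ultrafilter and let $\gamma\in{}^*\mathbb N$ realise $p$. Then the poset $\mathcal E_p$ is isomorphic to the linear order $\operatorname{CC}(\gamma)$.
   Context: View $\mathbb N$ as a structure in the language with a symbol for every relation and function on every $\mathbb N^k$, and let ${}^*\mathbb N$ be a monster model of its theory; ultrafilters in $\beta\mathbb N$ are identified with complete $1$-types over $\mathbb N$. For $u,v\in\beta\mathbb N$, $u\mathrel{\tilde\mid}v$ iff there are $\alpha\models u$, $\beta\models v$ in ${}^*\mathbb N$ with $\alpha\mid\beta$; $u=_\sim v$ iff $u\mathrel{\tilde\mid}v$ and $v\mathrel{\tilde\mid}u$. $\overline{\mathbb P}$ is the set of ultrafilters containing the set $\mathbb P$ of primes. For $p\in\overline{\mathbb P}$, $\mathcal E_p$ is the poset, ordered by $\mathrel{\tilde\mid}$, of $=_\sim$-classes of ultrafilters of the form $\operatorname{tp}(\gamma^\delta/\mathbb N)$ with $\gamma\models p$, $\delta\in{}^*\mathbb N$. $\operatorname{CC}(\gamma)$ is the set of cuts $(L,R)$ of $\operatorname{dcl}(\{\gamma\})=\{f(\gamma):f\colon\mathbb N\to\mathbb N\}$ (with $L\cup R=\operatorname{dcl}(\{\gamma\})$, $L\le R$) realised by some element of ${}^*\mathbb N$, i.e. the quantifier-free $1$-types in the language $\{\le\}$ over $\operatorname{dcl}(\{\gamma\})$, with their natural linear order. *)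

theory Defs
  imports "HOL-Computational_Algebra.Primes"
begin

unbundle cardinal_syntax

section \<open>The full language on the natural numbers\<close>

text \<open>
  A function symbol is a function on lists of naturals, a relation symbol a set of such lists.
  The arity is the number of arguments a symbol is applied to: applied to \<open>k\<close> arguments, \<open>f\<close> names
  the restriction of \<open>f\<close> to lists of length \<open>k\<close>, i.e. a function from the \<open>k\<close>-th power
  of the naturals to the naturals, and similarly for relations. Every function and every relation
  of every arity is named in this way.
\<close>

datatype tm = Var nat | App "nat list \<Rightarrow> nat" "tm list"

datatype fm =
    Eq tm tm
  | Rel "nat list set" "tm list"
  | Neg fm
  | Conj fm fm
  | Ex nat fm

primrec tm_vars :: "tm \<Rightarrow> nat set" where
  "tm_vars (Var n) = {n}"
| "tm_vars (App f ts) = \<Union> (set (map tm_vars ts))"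

primrec free_vars :: "fm \<Rightarrow> nat set" where
  "free_vars (Eq s t) = tm_vars s \<union> tm_vars t"
| "free_vars (Rel R ts) = \<Union> (set (map tm_vars ts))"
| "free_vars (Neg \<phi>) = free_vars \<phi>"
| "free_vars (Conj \<phi> \<psi>) = free_vars \<phi> \<union> free_vars \<psi>"
| "free_vars (Ex n \<phi>) = free_vars \<phi> - {n}"

record 'a struct =
  fn :: "(nat list \<Rightarrow> nat) \<Rightarrow> 'a list \<Rightarrow> 'a"
  rel :: "nat list set \<Rightarrow> 'a list \<Rightarrow> bool"

primrec eval :: "'a struct \<Rightarrow> (nat \<Rightarrow> 'a) \<Rightarrow> tm \<Rightarrow> 'a" where
  "eval M e (Var n) = e n"
| "eval M e (App f ts) = fn M f (map (eval M e) ts)"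

primrec sat :: "'a struct \<Rightarrow> (nat \<Rightarrow> 'a) \<Rightarrow> fm \<Rightarrow> bool" where
  "sat M e (Eq s t) \<longleftrightarrow> eval M e s = eval M e t"
| "sat M e (Rel R ts) \<longleftrightarrow> rel M R (map (eval M e) ts)"
| "sat M e (Neg \<phi>) \<longleftrightarrow> \<not> sat M e \<phi>"
| "sat M e (Conj \<phi> \<psi>) \<longleftrightarrow> sat M e \<phi> \<and> sat M e \<psi>"
| "sat M e (Ex n \<phi>) \<longleftrightarrow> (\<exists>a. sat M (e(n := a)) \<phi>)"

definition std_nat :: "nat struct" where
  "std_nat = \<lparr>fn = (\<lambda>f xs. f xs), rel = (\<lambda>R xs. xs \<in> R)\<rparr>"

definition models_sentence :: "'a struct \<Rightarrow> fm \<Rightarrow> bool" where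
  "models_sentence M \<phi> \<longleftrightarrow> (\<forall>e. sat M e \<phi>)"

definition models_Th_nat :: "'a struct \<Rightarrow> bool" where
  "models_Th_nat M \<longleftrightarrow>
     (\<forall>\<phi>. free_vars \<phi> = {} \<longrightarrow> models_sentence std_nat \<phi> \<longrightarrow> models_sentence M \<phi>)"


section \<open>Monster models\<close>

text \<open>
  A formula with parameters in \<open>A\<close> and one free variable is a pair \<open>(\<phi>, e)\<close>: the free variable is
  the variable \<open>0\<close>, and the other variables free in \<open>\<phi>\<close> stand for parameters, given by \<open>e\<close>.
\<close>

definition param_fms :: "'a set \<Rightarrow> (fm \<times> (nat \<Rightarrow> 'a)) set" where
  "param_fms A = {(\<phi>, e). \<forall>n \<in> free_vars \<phi> - {0}. e n \<in> A}"

definition realises_fms :: "'a struct \<Rightarrow> 'a \<Rightarrow> (fm \<times> (nat \<Rightarrow> 'a)) set \<Rightarrow> bool" where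
  "realises_fms M b \<Gamma> \<longleftrightarrow> (\<forall>(\<phi>, e) \<in> \<Gamma>. sat M (e(0 := b)) \<phi>)"

definition saturated :: "'k rel \<Rightarrow> 'a struct \<Rightarrow> bool" where
  "saturated \<kappa> M \<longleftrightarrow>
     (\<forall>A. |A| <o \<kappa> \<longrightarrow>
       (\<forall>\<Gamma> \<subseteq> param_fms A.
         (\<forall>\<Delta> \<subseteq> \<Gamma>. finite \<Delta> \<longrightarrow> (\<exists>b. realises_fms M b \<Delta>)) \<longrightarrow>
         (\<exists>b. realises_fms M b \<Gamma>)))"

definition partial_elementary :: "'a struct \<Rightarrow> 'a set \<Rightarrow> ('a \<Rightarrow> 'a) \<Rightarrow> bool" where
  "partial_elementary M A f \<longleftrightarrow>
     (\<forall>\<phi> e. (\<forall>n \<in> free_vars \<phi>. e n \<in> A) \<longrightarrow> (sat M e \<phi> \<longleftrightarrow> sat M (f \<circ> e) \<phi>))"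

definition automorphism :: "'a struct \<Rightarrow> ('a \<Rightarrow> 'a) \<Rightarrow> bool" where
  "automorphism M g \<longleftrightarrow> bij g
     \<and> (\<forall>f xs. g (fn M f xs) = fn M f (map g xs))
     \<and> (\<forall>R xs. rel M R xs \<longleftrightarrow> rel M R (map g xs))"

definition strongly_homogeneous :: "'k rel \<Rightarrow> 'a struct \<Rightarrow> bool" where
  "strongly_homogeneous \<kappa> M \<longleftrightarrow>
     (\<forall>A f. |A| <o \<kappa> \<longrightarrow> partial_elementary M A f \<longrightarrow>
       (\<exists>g. automorphism M g \<and> (\<forall>a \<in> A. g a = f a)))"

text \<open>
  The continuum is the cardinality of the language, so \<open>\<kappa>\<close> exceeds the size of the language
  and of every \<open>dcl {\<gamma>}\<close>. No further largeness of \<open>\<kappa>\<close> is imposed.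
\<close>

definition monster :: "'k rel \<Rightarrow> 'a struct \<Rightarrow> bool" where
  "monster \<kappa> M \<longleftrightarrow>
     Card_order \<kappa> \<and> |UNIV :: nat set set| <o \<kappa> \<and>
     models_Th_nat M \<and> saturated \<kappa> M \<and> strongly_homogeneous \<kappa> M"


section \<open>Arithmetic of the monster\<close>

definition star_le :: "'a struct \<Rightarrow> 'a \<Rightarrow> 'a \<Rightarrow> bool" where
  "star_le M a b \<longleftrightarrow> rel M {[m, n] | m n. m \<le> n} [a, b]"

definition star_dvd :: "'a struct \<Rightarrow> 'a \<Rightarrow> 'a \<Rightarrow> bool" where
  "star_dvd M a b \<longleftrightarrow> rel M {[m, n] | m n. m dvd n} [a, b]"

text \<open>The functions below are only ever applied to lists of length two, resp. one; their values
  on other lists belong to symbols of other arities.\<close>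

definition star_pow :: "'a struct \<Rightarrow> 'a \<Rightarrow> 'a \<Rightarrow> 'a" where
  "star_pow M a b = fn M (\<lambda>xs. (xs ! 0) ^ (xs ! 1)) [a, b]"

definition star_fun :: "'a struct \<Rightarrow> (nat \<Rightarrow> nat) \<Rightarrow> 'a \<Rightarrow> 'a" where
  "star_fun M f a = fn M (\<lambda>xs. f (xs ! 0)) [a]"

definition dcl1 :: "'a struct \<Rightarrow> 'a \<Rightarrow> 'a set" where
  "dcl1 M \<gamma> = {star_fun M f \<gamma> | f. True}"


section \<open>Ultrafilters as types, and divisibility\<close>

definition ultrafilter :: "'b filter \<Rightarrow> bool" where
  "ultrafilter u \<longleftrightarrow>
     u \<noteq> bot \<and> (\<forall>P. eventually P u \<or> eventually (\<lambda>x. \<not> P x) u)"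

definition star_mem :: "'a struct \<Rightarrow> 'a \<Rightarrow> nat set \<Rightarrow> bool" where
  "star_mem M \<alpha> A \<longleftrightarrow> rel M {[n] | n. n \<in> A} [\<alpha>]"

text \<open>
  A complete type over the naturals in the full language is identified with an ultrafilter: the one
  consisting of the sets \<open>A\<close> with \<open>\<alpha> \<in> *A\<close>. In a model of the theory these sets are closed under
  supersets and finite intersections, so the filter they generate has no further members.
  Accordingly, that \<open>\<alpha>\<close> realises \<open>u\<close> is the equation \<open>tp M \<alpha> = u\<close>.
\<close>

definition tp :: "'a struct \<Rightarrow> 'a \<Rightarrow> nat filter" where
  "tp M \<alpha> = (INF A \<in> {A. star_mem M \<alpha> A}. principal A)"

definition tdvd :: "'a struct \<Rightarrow> nat filter \<Rightarrow> nat filter \<Rightarrow> bool" where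
  "tdvd M u v \<longleftrightarrow> (\<exists>\<alpha> \<beta>. tp M \<alpha> = u \<and> tp M \<beta> = v \<and> star_dvd M \<alpha> \<beta>)"

definition tequiv :: "'a struct \<Rightarrow> (nat filter) rel" where
  "tequiv M = {(u, v). ultrafilter u \<and> ultrafilter v \<and> tdvd M u v \<and> tdvd M v u}"

definition prime_ultrafilter :: "nat filter \<Rightarrow> bool" where
  "prime_ultrafilter p \<longleftrightarrow> ultrafilter p \<and> eventually prime p"

definition E_carrier :: "'a struct \<Rightarrow> nat filter \<Rightarrow> nat filter set set" where
  "E_carrier M p = {tequiv M `` {tp M (star_pow M \<gamma> \<delta>)} | \<gamma> \<delta>. tp M \<gamma> = p}"

definition E_le :: "'a struct \<Rightarrow> nat filter set \<Rightarrow> nat filter set \<Rightarrow> bool" where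
  "E_le M X Y \<longleftrightarrow> (\<exists>u \<in> X. \<exists>v \<in> Y. tdvd M u v)"


section \<open>Realised cuts\<close>

text \<open>
  A cut stands for the quantifier-free order type of an element \<open>x\<close> over \<open>dcl {\<gamma>}\<close>, hence \<open>L\<close> and
  \<open>R\<close> are exactly the sets of elements below and above \<open>x\<close>. They share a point precisely when
  \<open>x\<close> itself lies in \<open>dcl {\<gamma>}\<close>.
\<close>

definition is_cut :: "'a struct \<Rightarrow> 'a set \<Rightarrow> 'a set \<times> 'a set \<Rightarrow> bool" where
  "is_cut M D = (\<lambda>(L, R). L \<union> R = D \<and> (\<forall>l \<in> L. \<forall>r \<in> R. star_le M l r))"

definition realises_cut :: "'a struct \<Rightarrow> 'a set \<Rightarrow> 'a \<Rightarrow> 'a set \<times> 'a set \<Rightarrow> bool" where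
  "realises_cut M D x = (\<lambda>(L, R). L = {d \<in> D. star_le M d x} \<and> R = {d \<in> D. star_le M x d})"

definition CC :: "'a struct \<Rightarrow> 'a \<Rightarrow> ('a set \<times> 'a set) set" where
  "CC M \<gamma> = {C. is_cut M (dcl1 M \<gamma>) C \<and> (\<exists>x. realises_cut M (dcl1 M \<gamma>) x C)}"

definition cut_le :: "'a set \<times> 'a set \<Rightarrow> 'a set \<times> 'a set \<Rightarrow> bool" where
  "cut_le C C' \<longleftrightarrow> fst C \<subseteq> fst C' \<and> snd C' \<subseteq> snd C"

end

theory Submission
  imports Defs "HOL-Library.Infinite_Set"
begin

text \<open>
  For an element \<open>\<gamma>\<close> realising a prime ultrafilter \<open>p\<close> and exponents \<open>\<delta>\<close>, \<open>\<delta>'\<close>, the divisibility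
  \<open>tp (\<gamma>^\<delta>) | tp (\<gamma>^\<delta>')\<close> holds iff \<open>\<delta>' \<le> f \<gamma>\<close> implies \<open>\<delta> \<le> f \<gamma>\<close> for all \<open>f\<close>, i.e. iff the cut of
  \<open>\<delta>\<close> lies below that of \<open>\<delta>'\<close>. One direction holds because the set of all \<open>n\<close> divisible by
  \<open>q^(f q + 1)\<close> for some prime \<open>q\<close> is closed under multiples and contains \<open>\<gamma>^\<delta>\<close> iff \<open>f \<gamma> < \<delta>\<close>.
  For the other one, saturation yields an \<open>x \<ge> \<delta>\<close> with \<open>tp (\<gamma>, x) = tp (\<gamma>, \<delta>')\<close>: if \<open>(\<gamma>, \<delta>')\<close> lies in
  a set \<open>A\<close> of pairs, then either the fibre of \<open>A\<close> over \<open>\<gamma>\<close> is unbounded, or its maximum is of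
  the form \<open>f \<gamma>\<close>, is at least \<open>\<delta>'\<close>, and therefore at least \<open>\<delta>\<close>.
\<close>

section \<open>Transfer from the standard model\<close>

lemma finite_tm_vars: "finite (tm_vars t)"
  by (induction t) auto

lemma finite_free_vars: "finite (free_vars \<phi>)"
  by (induction \<phi>) (auto simp: finite_tm_vars)

text \<open>In a model of the theory, the sets \<open>A\<close> related to \<open>x\<close> and
  \<open>y\<close> in this way form the ultrafilter on pairs that is the type of
  \<open>(x, y)\<close>.\<close>

definition star_mem2 :: "'a struct \<Rightarrow> 'a \<Rightarrow> 'a \<Rightarrow> (nat \<times> nat) set \<Rightarrow> bool" where
  "star_mem2 M x y A \<longleftrightarrow> rel M {[m, n] | m n. (m, n) \<in> A} [x, y]"

lemma star_dvd_iff: "star_dvd M x y \<longleftrightarrow> star_mem2 M x y {(m, n). m dvd n}"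
  by (simp add: star_dvd_def star_mem2_def)

locale Th_nat_model =
  fixes M :: "'a struct"
  assumes Th_nat: "models_Th_nat M"
begin

text \<open>The theory only speaks of sentences, so the free variables are closed off universally
  one at a time, by induction on their number.\<close>

lemma transfer:
  assumes "\<And>e. sat std_nat e \<phi>"
  shows "sat M e \<phi>"
  using assms
proof (induction "card (free_vars \<phi>)" arbitrary: \<phi> e)
  case 0
  then show ?case
    using Th_nat finite_free_vars
    by (auto simp: models_Th_nat_def models_sentence_def)
next
  case (Suc k)
  then obtain n where n: "n \<in> free_vars \<phi>"
    by (metis card.empty equals0I nat.distinct(1))
  let ?\<psi> = "Neg (Ex n (Neg \<phi>))"
  have "k = card (free_vars ?\<psi>)"
    using Suc.hyps(2) n finite_free_vars by simp
  moreover have "sat std_nat e ?\<psi>" for e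
    using Suc.prems by simp
  ultimately have "sat M e ?\<psi>"
    by (rule Suc.hyps(1))
  \<comment> \<open>The universal statement is instantiated at the value that \<open>e\<close>
    already gives to \<open>n\<close>; the trivial update must survive simplification to match
    it.\<close>
  then have "sat M (e(n := e n)) \<phi>"
    by (simp del: fun_upd_triv)
  then show ?case by simp
qed

lemma transfer_imp:
  assumes "\<And>e. sat std_nat e \<phi> \<Longrightarrow> sat std_nat e \<psi>" and "sat M e \<phi>"
  shows "sat M e \<psi>"
  using transfer[of "Neg (Conj \<phi> (Neg \<psi>))" e] assms by auto

lemma transfer_iff:
  assumes "\<And>e. sat std_nat e \<phi> \<longleftrightarrow> sat std_nat e \<psi>"
  shows "sat M e \<phi> \<longleftrightarrow> sat M e \<psi>"
  using transfer_imp assms by blast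

section \<open>Starred sets of numbers and of pairs\<close>

abbreviation Rel1 :: "nat set \<Rightarrow> tm \<Rightarrow> fm" where
  "Rel1 A s \<equiv> Rel {[n] | n. n \<in> A} [s]"

abbreviation Rel2 :: "(nat \<times> nat) set \<Rightarrow> tm \<Rightarrow> tm \<Rightarrow> fm" where
  "Rel2 A s t \<equiv> Rel {[m, n] | m n. (m, n) \<in> A} [s, t]"

abbreviation Fun1 :: "(nat \<Rightarrow> nat) \<Rightarrow> tm \<Rightarrow> tm" where
  "Fun1 f t \<equiv> App (\<lambda>xs. f (xs ! 0)) [t]"

abbreviation Pow :: "tm \<Rightarrow> tm \<Rightarrow> tm" where
  "Pow s t \<equiv> App (\<lambda>xs. (xs ! 0) ^ (xs ! 1)) [s, t]"

lemma star_mem2_Int: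
  "star_mem2 M x y (A \<inter> B) \<longleftrightarrow> star_mem2 M x y A \<and> star_mem2 M x y B"
  using transfer_iff[of "Rel2 (A \<inter> B) (Var 0) (Var 1)"
      "Conj (Rel2 A (Var 0) (Var 1)) (Rel2 B (Var 0) (Var 1))" "(\<lambda>_. y)(0 := x)"]
  by (simp add: star_mem2_def std_nat_def)

lemma star_mem2_Compl: "star_mem2 M x y (- A) \<longleftrightarrow> \<not> star_mem2 M x y A"
  using transfer_iff[of "Rel2 (- A) (Var 0) (Var 1)"
      "Neg (Rel2 A (Var 0) (Var 1))" "(\<lambda>_. y)(0 := x)"]
  by (simp add: star_mem2_def std_nat_def)

lemma star_mem2_mono: "A \<subseteq> B \<Longrightarrow> star_mem2 M x y A \<Longrightarrow> star_mem2 M x y B"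
  by (metis inf.absorb1 star_mem2_Int)

lemma star_mem2_UNIV: "star_mem2 M x y UNIV"
  by (metis star_mem2_Compl star_mem2_mono subset_UNIV)

text \<open>Since \<open>y\<close> is arbitrary, a condition on \<open>x\<close> alone can be
  intersected with conditions on pairs, or moved from one second coordinate to another.\<close>

lemma star_mem_iff_mem2_fst: "star_mem M x A \<longleftrightarrow> star_mem2 M x y {(m, n). m \<in> A}"
  using transfer_iff[of "Rel1 A (Var 0)" "Rel2 {(m, n). m \<in> A} (Var 0) (Var 1)" "(\<lambda>_. y)(0 := x)"]
  by (simp add: star_mem_def star_mem2_def std_nat_def)

lemma star_mem_iff_mem2_snd: "star_mem M y A \<longleftrightarrow> star_mem2 M x y {(m, n). n \<in> A}"
  using transfer_iff[of "Rel1 A (Var 1)" "Rel2 {(m, n). n \<in> A} (Var 0) (Var 1)" "(\<lambda>_. y)(0 := x)"]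
  by (simp add: star_mem_def star_mem2_def std_nat_def)

lemma star_mem_Int: "star_mem M x (A \<inter> B) \<longleftrightarrow> star_mem M x A \<and> star_mem M x B"
proof -
  have "{(m, n). m \<in> A \<inter> B} = {(m, n). m \<in> A} \<inter> {(m, n::nat). m \<in> B}"
    by auto
  then show ?thesis
    by (metis star_mem2_Int star_mem_iff_mem2_fst)
qed

lemma star_mem_Compl: "star_mem M x (- A) \<longleftrightarrow> \<not> star_mem M x A"
proof -
  have "{(m, n). m \<in> - A} = - {(m, n::nat). m \<in> A}"
    by auto
  then show ?thesis
    by (metis star_mem2_Compl star_mem_iff_mem2_fst)
qed

lemma star_mem_mono: "A \<subseteq> B \<Longrightarrow> star_mem M x A \<Longrightarrow> star_mem M x B"
  by (metis inf.absorb1 star_mem_Int)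

lemma star_mem_UNIV: "star_mem M x UNIV"
  by (metis star_mem_Compl star_mem_mono subset_UNIV)

lemma star_fun_le_iff: "star_le M (star_fun M f x) y \<longleftrightarrow> star_mem2 M x y {(m, n). f m \<le> n}"
  using transfer_iff[of "Rel2 {(m, n). m \<le> n} (Fun1 f (Var 0)) (Var 1)"
      "Rel2 {(m, n). f m \<le> n} (Var 0) (Var 1)" "(\<lambda>_. y)(0 := x)"]
  by (simp add: star_le_def star_fun_def star_mem2_def std_nat_def)

lemma le_star_fun_iff: "star_le M y (star_fun M f x) \<longleftrightarrow> star_mem2 M x y {(m, n). n \<le> f m}"
  using transfer_iff[of "Rel2 {(m, n). m \<le> n} (Var 1) (Fun1 f (Var 0))"
      "Rel2 {(m, n). n \<le> f m} (Var 0) (Var 1)" "(\<lambda>_. y)(0 := x)"]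
  by (simp add: star_le_def star_fun_def star_mem2_def std_nat_def)

lemma star_fun_le_star_fun_iff:
  "star_le M (star_fun M f x) (star_fun M g x) \<longleftrightarrow> star_mem M x {m. f m \<le> g m}"
  using transfer_iff[of "Rel2 {(m, n). m \<le> n} (Fun1 f (Var 0)) (Fun1 g (Var 0))"
      "Rel1 {m. f m \<le> g m} (Var 0)" "\<lambda>_. x"]
  by (simp add: star_le_def star_fun_def star_mem_def std_nat_def)

lemma star_mem2_star_fun_iff:
  "star_mem2 M x (star_fun M f x) A \<longleftrightarrow> star_mem M x {m. (m, f m) \<in> A}"
  using transfer_iff[of "Rel2 A (Var 0) (Fun1 f (Var 0))"
      "Rel1 {m. (m, f m) \<in> A} (Var 0)" "\<lambda>_. x"]
  by (simp add: star_fun_def star_mem2_def star_mem_def std_nat_def)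

lemma star_mem_star_pow_iff: "star_mem M (star_pow M x y) A \<longleftrightarrow> star_mem2 M x y {(m, n). m ^ n \<in> A}"
  using transfer_iff[of "Rel1 A (Pow (Var 0) (Var 1))"
      "Rel2 {(m, n). m ^ n \<in> A} (Var 0) (Var 1)" "(\<lambda>_. y)(0 := x)"]
  by (simp add: star_pow_def star_mem2_def star_mem_def std_nat_def)

lemma star_pow_dvd: "star_le M y z \<Longrightarrow> star_dvd M (star_pow M x y) (star_pow M x z)"
  using transfer_imp[of "Rel2 {(m, n). m \<le> n} (Var 1) (Var 2)"
      "Rel2 {(m, n). m dvd n} (Pow (Var 0) (Var 1)) (Pow (Var 0) (Var 2))" "(\<lambda>_. z)(0 := x, 1 := y)"]
  by (simp add: star_pow_def star_dvd_def star_le_def std_nat_def le_imp_power_dvd)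

lemma star_dvd_refl: "star_dvd M x x"
  using transfer[of "Rel2 {(m, n). m dvd n} (Var 0) (Var 0)" "\<lambda>_. x"]
  by (simp add: star_dvd_def std_nat_def)

lemma star_dvd_trans: "star_dvd M x y \<Longrightarrow> star_dvd M y z \<Longrightarrow> star_dvd M x z"
  using transfer_imp[of "Conj (Rel2 {(m, n). m dvd n} (Var 0) (Var 1))
      (Rel2 {(m, n). m dvd n} (Var 1) (Var 2))" "Rel2 {(m, n). m dvd n} (Var 0) (Var 2)"
      "(\<lambda>_. z)(0 := x, 1 := y)"]
  by (auto simp: star_dvd_def std_nat_def intro: dvd_trans)

text \<open>An infinite set of naturals has members above every bound, and this is first-order in
  the bound, hence transfers to nonstandard \<open>c\<close>.\<close>

lemma unbounded_fibre:
  assumes "star_mem M x {m. infinite {n. (m, n) \<in> A}}"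
  shows "\<exists>y. star_le M c y \<and> star_mem2 M x y A"
  using transfer_imp[of "Rel1 {m. infinite {n. (m, n) \<in> A}} (Var 0)"
      "Ex 2 (Conj (Rel2 {(m, n). m \<le> n} (Var 1) (Var 2)) (Rel2 A (Var 0) (Var 2)))"
      "(\<lambda>_. c)(0 := x)"] assms
  by (simp add: star_mem_def star_mem2_def star_le_def std_nat_def infinite_nat_iff_unbounded_le)

section \<open>Types as ultrafilters\<close>

lemma eventually_tp: "eventually P (tp M x) \<longleftrightarrow> star_mem M x {n. P n}"
proof -
  have "eventually P (tp M x) \<longleftrightarrow> (\<exists>A \<in> {A. star_mem M x A}. eventually P (principal A))"
    unfolding tp_def
  proof (rule eventually_INF_base)
    show "{A. star_mem M x A} \<noteq> {}"
      using star_mem_UNIV by auto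
    fix A B
    assume "A \<in> {A. star_mem M x A}" "B \<in> {A. star_mem M x A}"
    then show "\<exists>C \<in> {A. star_mem M x A}. principal C \<le> inf (principal A) (principal B)"
      by (intro bexI[of _ "A \<inter> B"]) (auto simp: star_mem_Int)
  qed
  also have "\<dots> \<longleftrightarrow> star_mem M x {n. P n}"
    by (auto simp: eventually_principal intro: star_mem_mono[rotated])
  finally show ?thesis .
qed

lemma tp_eq_iff: "tp M x = tp M y \<longleftrightarrow> (\<forall>A. star_mem M x A \<longleftrightarrow> star_mem M y A)"
  by (metis Collect_mem_eq eventually_tp filter_eq_iff)

text \<open>An inclusion between ultrafilters is an equality: pass to complements.\<close>

lemma tp_eqI: "(\<And>A. star_mem M x A \<Longrightarrow> star_mem M y A) \<Longrightarrow> tp M x = tp M y"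
  unfolding tp_eq_iff using star_mem_Compl by blast

lemma ultrafilter_tp: "ultrafilter (tp M x)"
proof -
  have "star_mem M x {n. P n} \<or> star_mem M x {n. \<not> P n}" for P
    using star_mem_Compl[of x "{n. P n}"] by (simp add: Collect_neg_eq)
  moreover have "\<not> star_mem M x {}"
    using star_mem_Compl[of x UNIV] star_mem_UNIV by simp
  ultimately show ?thesis
    by (simp add: ultrafilter_def trivial_limit_def eventually_tp)
qed

section \<open>Divisibility between types of powers\<close>

lemma tdvd_tp_refl: "tdvd M (tp M x) (tp M x)"
  unfolding tdvd_def using star_dvd_refl by blast

text \<open>Sets closed under multiples serve as tests: one that contains \<open>x\<close> but not
  \<open>y\<close> refutes divisibility.\<close>

lemma star_mem_dvd:
  assumes "star_dvd M x y" and "star_mem M x A" and "\<And>m n. m \<in> A \<Longrightarrow> m dvd n \<Longrightarrow> n \<in> A"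
  shows "star_mem M y A"
proof -
  have "star_mem2 M x y ({(m, n). m dvd n} \<inter> {(m, n). m \<in> A})"
    unfolding star_mem2_Int using assms(1,2) by (simp add: star_dvd_iff flip: star_mem_iff_mem2_fst)
  then have "star_mem2 M x y {(m, n). n \<in> A}"
    by (rule star_mem2_mono[rotated]) (use assms(3) in auto)
  then show ?thesis
    by (simp flip: star_mem_iff_mem2_snd)
qed

text \<open>A set of naturals cannot mention \<open>x\<close>, so the test set ranges over all
  primes \<open>q\<close>. For a power of a prime \<open>m\<close> only \<open>q = m\<close> can
  occur, and then the condition compares the exponent with \<open>f m\<close>.\<close>

lemma star_mem_prime_multiples_iff:
  assumes "star_mem M x {n. prime n}"
  shows "star_mem M (star_pow M x y) {n. \<exists>q. prime q \<and> q ^ Suc (f q) dvd n}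
    \<longleftrightarrow> \<not> star_le M y (star_fun M f x)"
proof -
  have "m ^ n \<in> {n. \<exists>q. prime q \<and> q ^ Suc (f q) dvd n} \<longleftrightarrow> \<not> n \<le> f m" if "prime m" for m n
  proof
    assume "m ^ n \<in> {n. \<exists>q. prime q \<and> q ^ Suc (f q) dvd n}"
    then obtain q where q: "prime q" "q ^ Suc (f q) dvd m ^ n"
      by auto
    then have "q dvd m"
      by (meson dvd_power dvd_trans prime_dvd_power zero_less_Suc)
    then have "q = m"
      using q that by (simp add: primes_dvd_imp_eq)
    then show "\<not> n \<le> f m"
      using q power_dvd_imp_le[of m "Suc (f m)" n] prime_gt_1_nat[OF that] by auto
  next
    assume "\<not> n \<le> f m"
    then have "m ^ Suc (f m) dvd m ^ n"
      by (intro le_imp_power_dvd) auto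
    with that show "m ^ n \<in> {n. \<exists>q. prime q \<and> q ^ Suc (f q) dvd n}"
      by blast
  qed
  \<comment> \<open>The two conditions are only shown to agree for prime bases, hence the
    restriction on both sides.\<close>
  then have *: "{(m, n). prime m} \<inter> {(m, n). m ^ n \<in> {n. \<exists>q. prime q \<and> q ^ Suc (f q) dvd n}}
      = {(m, n). prime m} \<inter> - {(m, n). n \<le> f m}"
    by blast
  have "star_mem2 M x y {(m, n). prime m}"
    using assms star_mem_iff_mem2_fst[of x "{n. prime n}" y] by simp
  then show ?thesis
    using arg_cong[OF *, of "star_mem2 M x y"]
    by (simp add: star_mem2_Int star_mem2_Compl star_mem_star_pow_iff le_star_fun_iff)
qed

lemma tdvd_star_pow_imp:
  assumes "tdvd M (tp M (star_pow M x y)) (tp M (star_pow M x z))"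
    and "star_mem M x {n. prime n}"
    and "star_le M z (star_fun M f x)"
  shows "star_le M y (star_fun M f x)"
proof (rule ccontr)
  let ?A = "{n. \<exists>q. prime q \<and> q ^ Suc (f q) dvd n}"
  assume "\<not> star_le M y (star_fun M f x)"
  then have 1: "star_mem M (star_pow M x y) ?A"
    using assms(2) star_mem_prime_multiples_iff by blast
  obtain a b where ab: "tp M a = tp M (star_pow M x y)" "tp M b = tp M (star_pow M x z)"
      "star_dvd M a b"
    using assms(1) unfolding tdvd_def by blast
  have "star_mem M a ?A"
    using 1 ab(1) unfolding tp_eq_iff by blast
  then have "star_mem M b ?A"
    by (rule star_mem_dvd[OF ab(3)]) (blast intro: dvd_trans)
  then have "star_mem M (star_pow M x z) ?A"
    using ab(2) unfolding tp_eq_iff by blast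
  then show False
    using assms(2,3) star_mem_prime_multiples_iff by blast
qed

section \<open>Realised cuts\<close>

definition cut :: "'a \<Rightarrow> 'a \<Rightarrow> 'a set \<times> 'a set" where
  "cut c x = ({d \<in> dcl1 M c. star_le M d x}, {d \<in> dcl1 M c. star_le M x d})"

lemma is_cut_cut: "is_cut M (dcl1 M c) (cut c x)"
proof -
  have "star_le M (star_fun M f c) x \<or> star_le M x (star_fun M f c)" for f
  proof -
    have "- {(m, n). f m \<le> n} \<subseteq> {(m, n). n \<le> f m}"
      by auto
    then show ?thesis
      unfolding star_fun_le_iff le_star_fun_iff using star_mem2_Compl star_mem2_mono by blast
  qed
  moreover have "star_le M (star_fun M f c) (star_fun M g c)"
    if "star_le M (star_fun M f c) x" "star_le M x (star_fun M g c)" for f g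
  proof -
    have "star_mem2 M c x ({(m, n). f m \<le> n} \<inter> {(m, n). n \<le> g m})"
      unfolding star_mem2_Int using that by (simp add: star_fun_le_iff le_star_fun_iff)
    then have "star_mem2 M c x {(m, n). m \<in> {m. f m \<le> g m}}"
      by (rule star_mem2_mono[rotated]) auto
    then show ?thesis
      unfolding star_fun_le_star_fun_iff by (simp only: star_mem_iff_mem2_fst[of c _ x])
  qed
  ultimately show ?thesis
    unfolding is_cut_def cut_def dcl1_def by auto
qed

lemma CC_eq_range: "CC M c = range (cut c)"
proof -
  have "realises_cut M (dcl1 M c) x C \<longleftrightarrow> C = cut c x" for x C
    by (auto simp: realises_cut_def cut_def split: prod.splits)
  then show ?thesis
    unfolding CC_def using is_cut_cut by auto
qed

text \<open>The upper halves determine the order, since \<open>dcl1\<close> is closed under predecessors.\<close>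

lemma cut_le_iff:
  "cut_le (cut c x) (cut c y) \<longleftrightarrow>
    (\<forall>f. star_le M y (star_fun M f c) \<longrightarrow> star_le M x (star_fun M f c))" (is "_ \<longleftrightarrow> ?R")
proof
  assume "cut_le (cut c x) (cut c y)"
  then show ?R
    unfolding cut_le_def cut_def dcl1_def by auto
next
  assume R: ?R
  have "star_le M (star_fun M f c) y" if fx: "star_le M (star_fun M f c) x" for f
  proof (rule ccontr)
    assume nle: "\<not> star_le M (star_fun M f c) y"
    have "- {(m, n). f m \<le> n} \<subseteq> {(m, n). n \<le> f m - 1}"
      by auto
    then have "star_le M y (star_fun M (\<lambda>m. f m - 1) c)"
      using nle star_mem2_Compl star_mem2_mono unfolding star_fun_le_iff le_star_fun_iff by blast
    then have "star_le M x (star_fun M (\<lambda>m. f m - 1) c)"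
      using R by blast
    \<comment> \<open>Subtraction is truncated, so \<open>f m \<le> n \<le> f m - 1\<close> is
      possible only if \<open>f m = 0\<close>. This concerns \<open>c\<close> alone, so it holds
      over \<open>y\<close> as well, where it contradicts \<open>nle\<close>.\<close>
    then have "star_mem2 M c x ({(m, n). f m \<le> n} \<inter> {(m, n). n \<le> f m - 1})"
      using fx by (simp add: star_mem2_Int star_fun_le_iff le_star_fun_iff)
    then have "star_mem2 M c x {(m, n). m \<in> {m. f m = 0}}"
      by (rule star_mem2_mono[rotated]) auto
    then have "star_mem2 M c y {(m, n). m \<in> {m. f m = 0}}"
      by (simp only: flip: star_mem_iff_mem2_fst)
    then have "star_mem2 M c y {(m, n). f m \<le> n}"
      by (rule star_mem2_mono[rotated]) auto
    then show False
      using nle star_fun_le_iff by blast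
  qed
  then show "cut_le (cut c x) (cut c y)"
    using R unfolding cut_le_def cut_def dcl1_def by auto
qed

end

section \<open>Consequences of saturation\<close>

locale monster_model =
  fixes \<kappa> :: "'k rel" and M :: "'a struct"
  assumes monster: "monster \<kappa> M"

sublocale monster_model \<subseteq> Th_nat_model M
  using monster by unfold_locales (simp add: monster_def)

context monster_model
begin

lemma finite_ordLess:
  assumes "finite A"
  shows "|A| <o \<kappa>"
proof -
  have "|A| <o natLeq"
    using assms by (simp add: finite_iff_ordLess_natLeq)
  also have "natLeq \<le>o |UNIV :: nat set set|"
    using infinite_iff_natLeq_ordLeq[of "UNIV :: nat set set"] by (simp add: Finite_Set.finite_set)
  also have "|UNIV :: nat set set| <o \<kappa>"
    using monster unfolding monster_def by blast
  finally show ?thesis .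
qed

text \<open>Closure under intersection reduces a finite subfamily to a single member, with
  \<open>UNIV\<close> handling the empty one. \<open>UNIV\<close> also makes the family nonempty, so
  that the realised formulas include the bound \<open>c\<close>.\<close>

lemma saturation:
  assumes Int: "\<And>A B. A \<in> \<A> \<Longrightarrow> B \<in> \<A> \<Longrightarrow> A \<inter> B \<in> \<A>"
    and "UNIV \<in> \<A>"
    and ex: "\<And>A. A \<in> \<A> \<Longrightarrow> \<exists>x. star_le M c x \<and> star_mem2 M b x A"
  shows "\<exists>x. star_le M c x \<and> (\<forall>A \<in> \<A>. star_mem2 M b x A)"
proof -
  \<comment> \<open>Variable \<open>0\<close> is reserved for the element to be found; variable
    \<open>1\<close> holds \<open>b\<close> and variable \<open>2\<close> holds
    \<open>c\<close>.\<close>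
  define e where "e = (\<lambda>_::nat. c)(1 := b)"
  define F where "F A = (Conj (Rel2 {(m, n). m \<le> n} (Var 2) (Var 0)) (Rel2 A (Var 1) (Var 0)), e)" for A
  have sat_F: "realises_fms M x (F ` \<B>) \<longleftrightarrow> (\<forall>A \<in> \<B>. star_le M c x \<and> star_mem2 M b x A)" for x \<B>
    by (auto simp: realises_fms_def F_def e_def star_le_def star_mem2_def)
  have "F ` \<A> \<subseteq> param_fms {b, c}"
    by (auto simp: param_fms_def F_def e_def)
  moreover have "\<exists>x. realises_fms M x \<Delta>" if "\<Delta> \<subseteq> F ` \<A>" "finite \<Delta>" for \<Delta>
  proof -
    obtain \<B> where \<B>: "\<B> \<subseteq> \<A>" "finite \<B>" "\<Delta> = F ` \<B>"
      using \<open>\<Delta> \<subseteq> F ` \<A>\<close> \<open>finite \<Delta>\<close> by (meson finite_subset_image)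
    have "\<Inter>\<B> \<in> \<A>"
      using \<B>(2,1) by (induction \<B>) (use assms(1,2) in auto)
    then obtain x where "star_le M c x" "star_mem2 M b x (\<Inter>\<B>)"
      using ex by blast
    then have "realises_fms M x \<Delta>"
      unfolding \<B>(3) sat_F by (meson Inter_lower star_mem2_mono)
    then show ?thesis ..
  qed
  moreover have "saturated \<kappa> M"
    using monster unfolding monster_def by blast
  ultimately have "\<exists>x. realises_fms M x (F ` \<A>)"
    unfolding saturated_def using finite_ordLess[of "{b, c}"] by simp
  then show ?thesis
    unfolding sat_F using assms(2) by blast
qed

text \<open>Two realisations \<open>b\<close>, \<open>b'\<close> of one type are allowed so that two
  uses are covered: \<open>b = b'\<close> turns comparison of cuts into divisibility, and a trivial
  lower bound gives amalgamation of types.\<close>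

lemma realise_above:
  assumes tp: "tp M b = tp M b'"
    and le: "\<And>f. star_le M a (star_fun M f b) \<Longrightarrow> star_le M c (star_fun M f b')"
  obtains x where "star_le M c x" "\<And>A. star_mem2 M b a A \<Longrightarrow> star_mem2 M b' x A"
proof -
  have "\<exists>x. star_le M c x \<and> star_mem2 M b' x A" if A: "star_mem2 M b a A" for A
  proof (cases "star_mem M b {m. infinite {n. (m, n) \<in> A}}")
    case True
    then show ?thesis
      using tp unbounded_fibre unfolding tp_eq_iff by blast
  next
    case False
    \<comment> \<open>The value matters only on finite nonempty fibres: infinite ones are removed
      next, and a point of \<open>A\<close> in the fibre makes it nonempty.\<close>
    define f where "f m = Max {n. (m, n) \<in> A}" for m
    have "star_mem2 M b a (A \<inter> - {(m, n). m \<in> {m. infinite {n. (m, n) \<in> A}}})"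
      using A False star_mem_iff_mem2_fst unfolding star_mem2_Int star_mem2_Compl by blast
    then have "star_mem2 M b a ({(m, n). n \<le> f m} \<inter> {(m, n). m \<in> {m. (m, f m) \<in> A}})"
    proof (rule star_mem2_mono[rotated], safe)
      fix m n
      assume mn: "(m, n) \<in> A" and fin: "finite {n. (m, n) \<in> A}"
      show "n \<le> f m"
        using mn fin unfolding f_def by (intro Max_ge) auto
      show "(m, f m) \<in> A"
        using mn fin Max_in[of "{n. (m, n) \<in> A}"] unfolding f_def by auto
    qed
    then have "star_le M a (star_fun M f b)" and "star_mem M b {m. (m, f m) \<in> A}"
      unfolding star_mem2_Int le_star_fun_iff using star_mem_iff_mem2_fst by blast+
    \<comment> \<open>The witness is the maximum \<open>f b'\<close> of the fibre over
      \<open>b'\<close>; that it lies in the fibre depends only on the type of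
      \<open>b\<close>.\<close>
    then have "star_le M c (star_fun M f b')" and "star_mem2 M b' (star_fun M f b') A"
      using le tp unfolding tp_eq_iff star_mem2_star_fun_iff by blast+
    then show ?thesis by blast
  qed
  then have "\<exists>x. star_le M c x \<and> (\<forall>A \<in> {A. star_mem2 M b a A}. star_mem2 M b' x A)"
    by (intro saturation) (auto simp: star_mem2_Int star_mem2_UNIV)
  then show thesis
    using that by blast
qed

text \<open>With lower bound \<open>0\<close> the comparison hypothesis of
  \<open>realise_above\<close> holds automatically.\<close>

lemma realise:
  assumes "tp M b = tp M b'"
  obtains x where "\<And>A. star_mem2 M b a A \<Longrightarrow> star_mem2 M b' x A"
proof (rule realise_above[OF assms])
  show "star_le M (star_fun M (\<lambda>_. 0) b') (star_fun M f b')" for f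
    by (simp add: star_fun_le_star_fun_iff star_mem_UNIV)
qed (use that in blast)

lemma tp_star_pow_eqI:
  assumes "\<And>A. star_mem2 M b a A \<Longrightarrow> star_mem2 M b' a' A"
  shows "tp M (star_pow M b a) = tp M (star_pow M b' a')"
  using assms by (intro tp_eqI) (simp add: star_mem_star_pow_iff)

text \<open>The two divisibilities may use different realisations \<open>b\<close>,
  \<open>b'\<close> of \<open>v\<close>. Moving \<open>a\<close> along with \<open>b\<close> to
  \<open>b'\<close> gives \<open>x\<close> of type \<open>u\<close> with \<open>x\<close> dividing
  \<open>b'\<close>, which divides \<open>c\<close>.\<close>

lemma tdvd_trans:
  assumes "tdvd M u v" and "tdvd M v w"
  shows "tdvd M u w"
proof -
  obtain a b b' c where *: "tp M a = u" "tp M b = v" "star_dvd M a b"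
      "tp M b' = v" "tp M c = w" "star_dvd M b' c"
    using assms unfolding tdvd_def by blast
  have "tp M b = tp M b'"
    using * by simp
  then obtain x where x: "\<And>A. star_mem2 M b a A \<Longrightarrow> star_mem2 M b' x A"
    by (rule realise) (rule that)
  \<comment> \<open>\<open>realise\<close> keeps the given element in the first coordinate, whereas
    here it is the multiple, in the second.\<close>
  have swap: "star_mem2 M y z A \<longleftrightarrow> star_mem2 M z y (prod.swap -` A)" for y z A
    using transfer_iff[of "Rel2 A (Var 0) (Var 1)" "Rel2 (prod.swap -` A) (Var 1) (Var 0)"
        "(\<lambda>_. z)(0 := y)"]
    by (simp add: star_mem2_def std_nat_def)
  have "tp M a = tp M x"
    using x star_mem_iff_mem2_snd[of a _ b] star_mem_iff_mem2_snd[of x _ b'] by (intro tp_eqI) simp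
  moreover have "star_dvd M x b'"
    using *(3) x unfolding star_dvd_iff swap[of _ b] swap[of _ b'] by blast
  ultimately show ?thesis
    unfolding tdvd_def using * star_dvd_trans by metis
qed

lemma tdvd_star_pow_iff:
  assumes "star_mem M c {n. prime n}"
  shows "tdvd M (tp M (star_pow M c x)) (tp M (star_pow M c y)) \<longleftrightarrow> cut_le (cut c x) (cut c y)"
proof
  assume "tdvd M (tp M (star_pow M c x)) (tp M (star_pow M c y))"
  then show "cut_le (cut c x) (cut c y)"
    unfolding cut_le_iff using tdvd_star_pow_imp assms by blast
next
  assume "cut_le (cut c x) (cut c y)"
  then obtain z where z: "star_le M x z" "\<And>A. star_mem2 M c y A \<Longrightarrow> star_mem2 M c z A"
    unfolding cut_le_iff using realise_above[of c c y x] by blast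
  have "tp M (star_pow M c y) = tp M (star_pow M c z)"
    using z(2) by (rule tp_star_pow_eqI)
  then show "tdvd M (tp M (star_pow M c x)) (tp M (star_pow M c y))"
    unfolding tdvd_def using star_pow_dvd[OF z(1)] by metis
qed

section \<open>The poset of classes and the isomorphism\<close>

definition pow_class :: "'a \<Rightarrow> 'a \<Rightarrow> nat filter set" where
  "pow_class c x = tequiv M `` {tp M (star_pow M c x)}"

text \<open>The base may be any realisation of the type; \<open>realise\<close> trades it for the
  fixed \<open>c\<close> by changing the exponent.\<close>

lemma E_carrier_eq_range: "E_carrier M (tp M c) = range (pow_class c)"
proof -
  have "pow_class b a \<in> range (pow_class c)" if eq: "tp M b = tp M c" for a b
  proof -
    obtain x where "\<And>A. star_mem2 M b a A \<Longrightarrow> star_mem2 M c x A"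
      by (rule realise[OF eq]) (rule that)
    then have "pow_class b a = pow_class c x"
      unfolding pow_class_def by (simp add: tp_star_pow_eqI[of b a c x])
    then show ?thesis by blast
  qed
  then show ?thesis
    unfolding E_carrier_def pow_class_def by blast
qed

text \<open>\<open>E_le\<close> asks for some pair of representatives; by transitivity of
  \<open>tdvd\<close> their choice is immaterial.\<close>

lemma E_le_pow_class_iff:
  "E_le M (pow_class c x) (pow_class c y) \<longleftrightarrow>
    tdvd M (tp M (star_pow M c x)) (tp M (star_pow M c y))"
proof
  show "E_le M (pow_class c x) (pow_class c y)
    \<Longrightarrow> tdvd M (tp M (star_pow M c x)) (tp M (star_pow M c y))"
    unfolding E_le_def pow_class_def tequiv_def using tdvd_trans by blast
  show "tdvd M (tp M (star_pow M c x)) (tp M (star_pow M c y))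
    \<Longrightarrow> E_le M (pow_class c x) (pow_class c y)"
    unfolding E_le_def pow_class_def tequiv_def using ultrafilter_tp tdvd_tp_refl by blast
qed

lemma pow_class_eq_iff:
  "pow_class c x = pow_class c y \<longleftrightarrow>
    E_le M (pow_class c x) (pow_class c y) \<and> E_le M (pow_class c y) (pow_class c x)"
proof
  assume "pow_class c x = pow_class c y"
  then show "E_le M (pow_class c x) (pow_class c y) \<and> E_le M (pow_class c y) (pow_class c x)"
    using E_le_pow_class_iff[of c x x] tdvd_tp_refl by simp
next
  assume "E_le M (pow_class c x) (pow_class c y) \<and> E_le M (pow_class c y) (pow_class c x)"
  then have "tdvd M (tp M (star_pow M c x)) v \<longleftrightarrow> tdvd M (tp M (star_pow M c y)) v"
    and "tdvd M v (tp M (star_pow M c x)) \<longleftrightarrow> tdvd M v (tp M (star_pow M c y))" for v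
    unfolding E_le_pow_class_iff using tdvd_trans by blast+
  then show "pow_class c x = pow_class c y"
    by (simp add: pow_class_def tequiv_def Image_def ultrafilter_tp)
qed

end

theorem theorem4p5:
  fixes \<kappa> :: "'k rel" and M :: "'a struct" and p :: "nat filter" and \<gamma> :: 'a
  assumes "monster \<kappa> M"
    and "prime_ultrafilter p"
    and "tp M \<gamma> = p"
  shows "\<exists>h. bij_betw h (E_carrier M p) (CC M \<gamma>) \<and>
             (\<forall>X \<in> E_carrier M p. \<forall>Y \<in> E_carrier M p. E_le M X Y \<longleftrightarrow> cut_le (h X) (h Y))"
proof -
  interpret monster_model \<kappa> M
    by unfold_locales (rule assms)
  have prime: "star_mem M \<gamma> {n. prime n}"
    using assms(2) unfolding prime_ultrafilter_def assms(3)[symmetric] eventually_tp by blast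
  have E_le_iff: "E_le M (pow_class \<gamma> x) (pow_class \<gamma> y) \<longleftrightarrow> cut_le (cut \<gamma> x) (cut \<gamma> y)" for x y
    unfolding E_le_pow_class_iff by (rule tdvd_star_pow_iff[OF prime])
  \<comment> \<open>Both orders are antisymmetric, so the order equivalence \<open>E_le_iff\<close>
    also yields the equivalence of equalities.\<close>
  have "C = C' \<longleftrightarrow> cut_le C C' \<and> cut_le C' C" for C C' :: "'a set \<times> 'a set"
    unfolding cut_le_def prod_eq_iff by blast
  then have eq_iff: "pow_class \<gamma> x = pow_class \<gamma> y \<longleftrightarrow> cut \<gamma> x = cut \<gamma> y" for x y
    unfolding pow_class_eq_iff E_le_iff by blast
  \<comment> \<open>The chosen exponent is not unique, but by \<open>eq_iff\<close> its cut is; the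
    same equivalence makes \<open>h\<close> injective.\<close>
  define h where "h X = cut \<gamma> (SOME x. pow_class \<gamma> x = X)" for X
  have h: "h (pow_class \<gamma> x) = cut \<gamma> x" for x
    unfolding h_def eq_iff by (rule someI) (rule refl)
  have "bij_betw h (range (pow_class \<gamma>)) (range (cut \<gamma>))"
    unfolding bij_betw_def inj_on_def by (auto simp: h eq_iff image_image)
  moreover have "E_carrier M p = range (pow_class \<gamma>)"
    using E_carrier_eq_range assms(3) by blast
  ultimately show ?thesis
    using h E_le_iff CC_eq_range by (intro exI[of _ h]) auto
qed

end
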